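(* Under the structural assumptions and cost model described in the context, the total arithmetic cost of constructing all coefficients of the $s$-stage explicit Runge--Kutta method is $$\mathcal C_{\mathrm{total}}=\mathcal C_D+\mathcal C_Q+\mathcal O(\mathcal N)\le\mathcal O(s^4),$$ where $\mathcal C_D$ and $\mathcal C_Q$ are the costs of solving the $D$-system and the $Q$-system and $\mathcal N$ is the total number of unknowns.
   Context: The unknown coefficients of an $s$-stage explicit Runge--Kutta method are determined by two linear systems solved sequentially: first the $D$-system, then (after substituting its result) the $Q$-system, with no nonlinear coupling between them. Structural assumptions: the $D$-system is block lower-triangular with $s_2-1$ square invertible diagonal blocks of sizes $d_1,\dots,d_{s_2-1}$, where $s_2=n(n+1)/2$ for a positive integer $n$, $s_2\le s$, and $d_i\le i$ for all $i$. The $Q$-system is block diagonal with $s-1$ square invertible blocks of sizes $q_1,\dots,q_{s-1}$, where $q_j\le l+1$ for all $j$ and $l$ is a nonnegative integer with $l+1\le s$. The total number of unknowns is $\mathcal N=\mathcal N_D+\mathcal N_Q=\sum_{i=1}^{s_2-1}d_i+\sum_{j=1}^{s-1}q_j$. Cost model: systems are solved by blockwise substitution; solving a dense $r\times r$ diagonal block requires $\Theta(r^3)$ arithmetic operations; in the $D$-system each coupling of block $i$ to a preceding block $j<i$ requires $\Theta(d_id_j)$ operations; assembly and simple vector operations require $\mathcal O(\mathcal N)$ operations. All implied constants are uniform (independent of $s,s_2,n,l$ and the block sizes). "$\le\mathcal O(s^4)$" means bounded above by a uniform constant times $s^4$. *)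

theory Defs
  imports Complex_Main "Jordan_Normal_Form.Matrix"
begin

text \<open>Blocks are numbered from 1: block \<open>i\<close> has size \<open>d i\<close>, and entry \<open>r < d i\<close> of block \<open>i\<close>
  sits at position \<open>offset d i + r\<close> (matrices and vectors are indexed from 0).\<close>

definition offset :: "(nat \<Rightarrow> nat) \<Rightarrow> nat \<Rightarrow> nat" where
  "offset d i = (\<Sum>k = 1..<i. d k)"

definition total_dim :: "(nat \<Rightarrow> nat) \<Rightarrow> nat \<Rightarrow> nat" where
  "total_dim d m = (\<Sum>k = 1..m. d k)"

definition block :: "(nat \<Rightarrow> nat) \<Rightarrow> real mat \<Rightarrow> nat \<Rightarrow> nat \<Rightarrow> real mat" where
  "block d A i j = mat (d i) (d j) (\<lambda>(r, c). A $$ (offset d i + r, offset d j + c))"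

definition segment :: "(nat \<Rightarrow> nat) \<Rightarrow> real vec \<Rightarrow> nat \<Rightarrow> real vec" where
  "segment d b i = vec (d i) (\<lambda>r. b $ (offset d i + r))"

primrec join :: "(nat \<Rightarrow> real vec) \<Rightarrow> nat \<Rightarrow> real vec" where
  "join X 0 = vNil"
| "join X (Suc m) = join X m @\<^sub>v X (Suc m)"

definition block_lower_triangular :: "(nat \<Rightarrow> nat) \<Rightarrow> nat \<Rightarrow> real mat \<Rightarrow> bool" where
  "block_lower_triangular d m A \<longleftrightarrow>
     A \<in> carrier_mat (total_dim d m) (total_dim d m) \<and>
     (\<forall>i\<in>{1..m}. \<forall>j\<in>{1..m}. i < j \<longrightarrow> block d A i j = 0\<^sub>m (d i) (d j))"

definition block_diagonal :: "(nat \<Rightarrow> nat) \<Rightarrow> nat \<Rightarrow> real mat \<Rightarrow> bool" where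
  "block_diagonal d m A \<longleftrightarrow>
     A \<in> carrier_mat (total_dim d m) (total_dim d m) \<and>
     (\<forall>i\<in>{1..m}. \<forall>j\<in>{1..m}. i \<noteq> j \<longrightarrow> block d A i j = 0\<^sub>m (d i) (d j))"

definition invertible_diagonal_blocks :: "(nat \<Rightarrow> nat) \<Rightarrow> nat \<Rightarrow> real mat \<Rightarrow> bool" where
  "invertible_diagonal_blocks d m A \<longleftrightarrow> (\<forall>i\<in>{1..m}. invertible_mat (block d A i i))"

text \<open>The data determining the coefficients of an explicit Runge--Kutta method. Matrix and right-hand
  side of the \<open>Q\<close>-system are functions of the solution of the \<open>D\<close>-system, which is
  substituted into them.\<close>

record rk_systems =
  stages :: nat
  param_n :: nat
  param_l :: nat
  size_D :: "nat \<Rightarrow> nat"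
  size_Q :: "nat \<Rightarrow> nat"
  mat_D :: "real mat"
  rhs_D :: "real vec"
  mat_Q :: "real vec \<Rightarrow> real mat"
  rhs_Q :: "real vec \<Rightarrow> real vec"

definition s2 :: "rk_systems \<Rightarrow> nat" where
  "s2 S = param_n S * (param_n S + 1) div 2"

definition unknowns_D :: "rk_systems \<Rightarrow> nat" where
  "unknowns_D S = total_dim (size_D S) (s2 S - 1)"

definition unknowns_Q :: "rk_systems \<Rightarrow> nat" where
  "unknowns_Q S = total_dim (size_Q S) (stages S - 1)"

definition unknowns :: "rk_systems \<Rightarrow> nat" where
  "unknowns S = unknowns_D S + unknowns_Q S"

text \<open>The assumptions on the \<open>Q\<close>-system are only imposed after substituting a solution of the
  \<open>D\<close>-system.\<close>

definition structural_assumptions :: "rk_systems \<Rightarrow> bool" where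
  "structural_assumptions S \<longleftrightarrow>
     0 < param_n S \<and> s2 S \<le> stages S \<and> param_l S + 1 \<le> stages S \<and>
     (\<forall>i\<in>{1..s2 S - 1}. size_D S i \<le> i) \<and>
     (\<forall>j\<in>{1..stages S - 1}. size_Q S j \<le> param_l S + 1) \<and>
     block_lower_triangular (size_D S) (s2 S - 1) (mat_D S) \<and>
     invertible_diagonal_blocks (size_D S) (s2 S - 1) (mat_D S) \<and>
     rhs_D S \<in> carrier_vec (unknowns_D S) \<and>
     (\<forall>x\<in>carrier_vec (unknowns_D S). mat_D S *\<^sub>v x = rhs_D S \<longrightarrow>
        block_diagonal (size_Q S) (stages S - 1) (mat_Q S x) \<and>
        invertible_diagonal_blocks (size_Q S) (stages S - 1) (mat_Q S x) \<and>
        rhs_Q S x \<in> carrier_vec (unknowns_Q S))"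

text \<open>Elementary routines return their result together with the number of arithmetic operations
  performed: \<open>dense_solve A b\<close> solves \<open>A x = b\<close>, and \<open>decouple A x y\<close> computes \<open>y - A x\<close>.
  \<open>overhead\<close> counts the operations spent on assembly and simple vector operations.\<close>

record routines =
  dense_solve :: "real mat \<Rightarrow> real vec \<Rightarrow> real vec \<times> nat"
  decouple :: "real mat \<Rightarrow> real vec \<Rightarrow> real vec \<Rightarrow> real vec \<times> nat"
  overhead :: "rk_systems \<Rightarrow> nat"

text \<open>\<open>c1, C1\<close> and \<open>c2, C2\<close> are the lower and upper constants of the two \<open>\<Theta>\<close>-bounds, and \<open>C3\<close> is
  the constant of the \<open>O\<close>-bound.\<close>

definition cost_model :: "real \<Rightarrow> real \<Rightarrow> real \<Rightarrow> real \<Rightarrow> real \<Rightarrow> routines \<Rightarrow> bool" where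
  "cost_model c1 C1 c2 C2 C3 P \<longleftrightarrow>
     (\<forall>r. \<forall>A\<in>carrier_mat r r. \<forall>b\<in>carrier_vec r. invertible_mat A \<longrightarrow>
        (let (x, k) = dense_solve P A b in
           x \<in> carrier_vec r \<and> A *\<^sub>v x = b \<and>
           c1 * real r ^ 3 \<le> real k \<and> real k \<le> C1 * real r ^ 3)) \<and>
     (\<forall>r t. \<forall>A\<in>carrier_mat r t. \<forall>x\<in>carrier_vec t. \<forall>y\<in>carrier_vec r.
        (let (z, k) = decouple P A x y in
           z = y - A *\<^sub>v x \<and>
           c2 * (real r * real t) \<le> real k \<and> real k \<le> C2 * (real r * real t))) \<and>
     (\<forall>S. structural_assumptions S \<longrightarrow> real (overhead P S) \<le> C3 * real (unknowns S))"

text \<open>\<open>eliminate P d A X i y j\<close> subtracts from \<open>y\<close> the couplings of block \<open>i\<close> to the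
  blocks \<open>1, \<dots>, j\<close>, whose solutions are given by \<open>X\<close>. Zero blocks are not skipped.\<close>

primrec eliminate ::
  "routines \<Rightarrow> (nat \<Rightarrow> nat) \<Rightarrow> real mat \<Rightarrow> (nat \<Rightarrow> real vec) \<Rightarrow> nat \<Rightarrow> real vec \<Rightarrow> nat \<Rightarrow> real vec \<times> nat"
where
  "eliminate P d A X i y 0 = (y, 0)"
| "eliminate P d A X i y (Suc j) =
     (let (y', k) = eliminate P d A X i y j;
          (y'', k') = decouple P (block d A i (Suc j)) (X (Suc j)) y'
      in (y'', k + k'))"

primrec forward_subst ::
  "routines \<Rightarrow> (nat \<Rightarrow> nat) \<Rightarrow> real mat \<Rightarrow> real vec \<Rightarrow> nat \<Rightarrow> (nat \<Rightarrow> real vec) \<times> nat"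
where
  "forward_subst P d A b 0 = (\<lambda>_. vNil, 0)"
| "forward_subst P d A b (Suc m) =
     (let (X, k) = forward_subst P d A b m;
          (y, k') = eliminate P d A X (Suc m) (segment d b (Suc m)) m;
          (x, k'') = dense_solve P (block d A (Suc m) (Suc m)) y
      in (X(Suc m := x), k + k' + k''))"

primrec diagonal_subst ::
  "routines \<Rightarrow> (nat \<Rightarrow> nat) \<Rightarrow> real mat \<Rightarrow> real vec \<Rightarrow> nat \<Rightarrow> (nat \<Rightarrow> real vec) \<times> nat"
where
  "diagonal_subst P d A b 0 = (\<lambda>_. vNil, 0)"
| "diagonal_subst P d A b (Suc m) =
     (let (X, k) = diagonal_subst P d A b m;
          (x, k') = dense_solve P (block d A (Suc m) (Suc m)) (segment d b (Suc m))
      in (X(Suc m := x), k + k'))"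

definition solve_D :: "routines \<Rightarrow> rk_systems \<Rightarrow> real vec \<times> nat" where
  "solve_D P S =
     (let (X, k) = forward_subst P (size_D S) (mat_D S) (rhs_D S) (s2 S - 1)
      in (join X (s2 S - 1), k))"

definition solve_Q :: "routines \<Rightarrow> rk_systems \<Rightarrow> real vec \<Rightarrow> real vec \<times> nat" where
  "solve_Q P S x =
     (let (Y, k) = diagonal_subst P (size_Q S) (mat_Q S x) (rhs_Q S x) (stages S - 1)
      in (join Y (stages S - 1), k))"

definition construct :: "routines \<Rightarrow> rk_systems \<Rightarrow> (real vec \<times> real vec) \<times> nat" where
  "construct P S =
     (let (x, k) = solve_D P S;
          (y, k') = solve_Q P S x
      in ((x, y), overhead P S + k + k'))"

definition cost_D :: "routines \<Rightarrow> rk_systems \<Rightarrow> nat" where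
  "cost_D P S = snd (solve_D P S)"

definition cost_Q :: "routines \<Rightarrow> rk_systems \<Rightarrow> nat" where
  "cost_Q P S = snd (solve_Q P S (fst (solve_D P S)))"

definition cost_total :: "routines \<Rightarrow> rk_systems \<Rightarrow> nat" where
  "cost_total P S = snd (construct P S)"

end

theory Submission
  imports Defs
begin

text \<open>The assumptions on the \<open>Q\<close>-system only hold for a genuine solution of the \<open>D\<close>-system, so the
  operation count rests on the correctness of forward substitution. Given that, with \<open>m = s2 - 1\<close>
  the \<open>D\<close>-system costs at most \<open>C1 \<Sum> d\<^sub>i\<^sup>3 + C2 (\<Sum> d\<^sub>i)\<^sup>2 \<le> (C1 + C2) m\<^sup>4\<close> because \<open>d\<^sub>i \<le> i \<le> m\<close>,
  and the \<open>Q\<close>-system at most \<open>C1 (s - 1) (l + 1)\<^sup>3 \<le> C1 s\<^sup>4\<close>. The number of unknowns is at most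
  \<open>2 s\<^sup>2\<close>.\<close>

section \<open>Index arithmetic of the block partition\<close>

lemma total_dim_0 [simp]: "total_dim d 0 = 0"
  by (simp add: total_dim_def)

lemma total_dim_Suc [simp]: "total_dim d (Suc m) = total_dim d m + d (Suc m)"
  by (simp add: total_dim_def)

lemma offset_Suc [simp]: "offset d (Suc m) = total_dim d m"
  by (simp add: offset_def total_dim_def atLeastLessThanSuc_atLeastAtMost)

lemma total_dim_mono: "m \<le> m' \<Longrightarrow> total_dim d m \<le> total_dim d m'"
  by (induction rule: dec_induct) auto

lemma total_dim_le: "(\<And>i. i \<in> {1..m} \<Longrightarrow> d i \<le> b) \<Longrightarrow> total_dim d m \<le> m * b"
  unfolding total_dim_def using sum_bounded_above[of "{1..m}" d b] by simp

lemma offset_add_less: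
  assumes "i \<in> {1..m}" "r < d i"
  shows "offset d i + r < total_dim d m"
proof -
  \<comment> \<open>Writing \<open>i\<close> as \<open>Suc k\<close> turns its offset into
    \<open>total_dim d k\<close>, so block \<open>i\<close> ends at
    \<open>total_dim d (Suc k)\<close>.\<close>
  obtain k where k: "i = Suc k" "Suc k \<le> m"
    using assms(1) by (cases i) auto
  show ?thesis
    using total_dim_mono[OF k(2), of d] assms(2) k(1) by simp
qed

text \<open>The blocks cover all positions, which allows a vector equation to be checked block by
  block.\<close>

lemma total_dim_cases:
  assumes "p < total_dim d m"
  obtains i r where "i \<in> {1..m}" "r < d i" "p = offset d i + r"
  using assms
proof (induction m arbitrary: thesis)
  case 0
  then show ?case by simp
next
  case (Suc m)
  show ?case
  proof (cases "p < total_dim d m")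
    case True
    obtain i r where "i \<in> {1..m}" "r < d i" "p = offset d i + r"
      by (rule Suc.IH[OF _ True])
    then show ?thesis
      using Suc.prems(1)[of i r] by simp
  next
    \<comment> \<open>A position past the first \<open>m\<close> blocks lies in the last one, at
      distance \<open>p - total_dim d m\<close> from its start.\<close>
    case False
    then show ?thesis
      using Suc.prems(1)[of "Suc m" "p - total_dim d m"] Suc.prems(2) by simp
  qed
qed

text \<open>Consecutive blocks are adjacent intervals; this later splits the scalar product of a row
  with a joined vector.\<close>

lemma sum_total_dim:
  fixes f :: "nat \<Rightarrow> 'a::comm_monoid_add"
  shows "(\<Sum>p = 0..<total_dim d m. f p) = (\<Sum>j = 1..m. \<Sum>c = 0..<d j. f (offset d j + c))"
proof (induction m)
  case (Suc m)
  have "(\<Sum>p = 0..<total_dim d m + d (Suc m). f p)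
      = (\<Sum>p = 0..<total_dim d m. f p) + (\<Sum>c = 0..<d (Suc m). f (total_dim d m + c))"
    using sum.atLeastLessThan_concat[of 0 "total_dim d m" "total_dim d m + d (Suc m)" f]
      sum.shift_bounds_nat_ivl[of f 0 "total_dim d m" "d (Suc m)"]
    by (simp add: add.commute)
  then show ?case
    using Suc.IH by simp
qed simp

section \<open>Block matrices acting on joined vectors\<close>

lemma block_carrier [simp]: "block d A i j \<in> carrier_mat (d i) (d j)"
  by (simp add: block_def)

lemma dim_row_block [simp]: "dim_row (block d A i j) = d i"
  by (simp add: block_def)

lemma segment_carrier [simp]: "segment d b i \<in> carrier_vec (d i)"
  by (simp add: segment_def)

lemma join_carrier:
  "(\<And>j. j \<in> {1..m} \<Longrightarrow> X j \<in> carrier_vec (d j)) \<Longrightarrow> join X m \<in> carrier_vec (total_dim d m)"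
  by (induction m) auto

lemma join_index:
  assumes "\<And>j. j \<in> {1..m} \<Longrightarrow> X j \<in> carrier_vec (d j)" "j \<in> {1..m}" "c < d j"
  shows "join X m $ (offset d j + c) = X j $ c"
  using assms
proof (induction m)
  case (Suc m)
  have dims: "dim_vec (join X m) = total_dim d m" "dim_vec (X (Suc m)) = d (Suc m)"
    using join_carrier[of m X d] Suc.prems(1) by auto
  show ?case
  proof (cases "j = Suc m")
    case True
    then show ?thesis
      using dims Suc.prems(3) by simp
  next
    case False
    then have "j \<in> {1..m}"
      using Suc.prems(2) by auto
    then show ?thesis
      using offset_add_less[of j m c d] Suc dims by simp
  qed
qed simp

text \<open>Splitting the scalar product of one matrix row along the block partition gives one
  product per block column, whatever the zero pattern of \<open>A\<close>.\<close>

lemma mult_mat_join_index: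
  assumes A: "A \<in> carrier_mat (total_dim d m) (total_dim d m)"
    and X: "\<And>j. j \<in> {1..m} \<Longrightarrow> X j \<in> carrier_vec (d j)"
    and i: "i \<in> {1..m}" "r < d i"
  shows "(A *\<^sub>v join X m) $ (offset d i + r) = (\<Sum>j = 1..m. (block d A i j *\<^sub>v X j) $ r)"
proof -
  let ?p = "offset d i + r"
  have p: "?p < total_dim d m"
    using i by (rule offset_add_less)
  have join: "join X m $ (offset d j + c) = X j $ c" if "j \<in> {1..m}" "c < d j" for j c
    using X that by (rule join_index)
  have dim: "dim_vec (join X m) = total_dim d m"
    by (rule carrier_vecD, rule join_carrier) (rule X)
  have "(A *\<^sub>v join X m) $ ?p = (\<Sum>k = 0..<total_dim d m. A $$ (?p, k) * join X m $ k)"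
    using A p dim by (auto simp: scalar_prod_def)
  also have "\<dots> = (\<Sum>j = 1..m. \<Sum>c = 0..<d j.
      A $$ (?p, offset d j + c) * join X m $ (offset d j + c))"
    by (rule sum_total_dim)
  also have "\<dots> = (\<Sum>j = 1..m. \<Sum>c = 0..<d j. A $$ (?p, offset d j + c) * X j $ c)"
    by (intro sum.cong refl) (simp add: join)
  also have "\<dots> = (\<Sum>j = 1..m. (block d A i j *\<^sub>v X j) $ r)"
  proof (intro sum.cong refl)
    fix j assume "j \<in> {1..m}"
    then have "dim_vec (X j) = d j"
      using X by auto
    then show "(\<Sum>c = 0..<d j. A $$ (?p, offset d j + c) * X j $ c) = (block d A i j *\<^sub>v X j) $ r"
      using i(2) by (simp add: block_def scalar_prod_def)
  qed
  finally show ?thesis .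
qed

text \<open>Blocks above the diagonal vanish, so the block sum of row \<open>i\<close> stops at
  \<open>j = i\<close>. The truncated equations are exactly those that forward substitution
  establishes.\<close>

lemma mult_mat_join_eqI:
  assumes A: "block_lower_triangular d m A" and b: "b \<in> carrier_vec (total_dim d m)"
    and X: "\<And>j. j \<in> {1..m} \<Longrightarrow> X j \<in> carrier_vec (d j)"
    and eq: "\<And>i r. i \<in> {1..m} \<Longrightarrow> r < d i \<Longrightarrow>
      (\<Sum>j = 1..i. (block d A i j *\<^sub>v X j) $ r) = b $ (offset d i + r)"
  shows "A *\<^sub>v join X m = b"
proof (rule eq_vecI)
  have A': "A \<in> carrier_mat (total_dim d m) (total_dim d m)"
    using A by (simp add: block_lower_triangular_def)
  then show "dim_vec (A *\<^sub>v join X m) = dim_vec b"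
    using b by auto
  fix p assume "p < dim_vec b"
  then obtain i r where i: "i \<in> {1..m}" "r < d i" "p = offset d i + r"
    using b total_dim_cases[of p d m] by auto
  have "(\<Sum>j = 1..m. (block d A i j *\<^sub>v X j) $ r) = (\<Sum>j = 1..i. (block d A i j *\<^sub>v X j) $ r)"
  proof (intro sum.mono_neutral_right ballI)
    fix j assume j: "j \<in> {1..m} - {1..i}"
    then have "block d A i j = 0\<^sub>m (d i) (d j)" "X j \<in> carrier_vec (d j)"
      using A i(1) X by (auto simp: block_lower_triangular_def)
    then show "(block d A i j *\<^sub>v X j) $ r = 0"
      using i(2) by simp
  qed (use i in auto)
  then show "(A *\<^sub>v join X m) $ p = b $ p"
    using mult_mat_join_index[of A d m X i r, OF A' X i(1,2)] eq[OF i(1,2)] i(3) by simp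
qed

section \<open>Correctness and cost of blockwise substitution\<close>

lemma cost_model_dense_solve:
  assumes "cost_model c1 C1 c2 C2 C3 P" "A \<in> carrier_mat r r" "b \<in> carrier_vec r"
    "invertible_mat A" "dense_solve P A b = (x, k)"
  shows "x \<in> carrier_vec r" "A *\<^sub>v x = b" "real k \<le> C1 * real r ^ 3"
proof -
  have "let (x, k) = dense_solve P A b in
      x \<in> carrier_vec r \<and> A *\<^sub>v x = b \<and> c1 * real r ^ 3 \<le> real k \<and> real k \<le> C1 * real r ^ 3"
    using assms(1)[unfolded cost_model_def, THEN conjunct1] assms(2-4) by blast
  then show "x \<in> carrier_vec r" "A *\<^sub>v x = b" "real k \<le> C1 * real r ^ 3"
    by (simp_all add: assms(5))
qed

lemma cost_model_decouple:
  assumes "cost_model c1 C1 c2 C2 C3 P" "A \<in> carrier_mat r t" "x \<in> carrier_vec t"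
    "y \<in> carrier_vec r" "decouple P A x y = (z, k)"
  shows "z = y - A *\<^sub>v x" "real k \<le> C2 * (real r * real t)"
proof -
  have "let (z, k) = decouple P A x y in
      z = y - A *\<^sub>v x \<and> c2 * (real r * real t) \<le> real k \<and> real k \<le> C2 * (real r * real t)"
    using assms(1)[unfolded cost_model_def, THEN conjunct2, THEN conjunct1] assms(2-4) by blast
  then show "z = y - A *\<^sub>v x" "real k \<le> C2 * (real r * real t)"
    by (simp_all add: assms(5))
qed

text \<open>The coupling to block \<open>j\<close> costs at most \<open>C2 * d i * d j\<close>, and
  summing over \<open>j\<close> collects the sizes into \<open>total_dim d m\<close>.\<close>

lemma eliminate_correct:
  assumes "cost_model c1 C1 c2 C2 C3 P"
    and "\<And>j. j \<in> {1..m} \<Longrightarrow> X j \<in> carrier_vec (d j)" "y \<in> carrier_vec (d i)"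
    and "eliminate P d A X i y m = (z, k)"
  shows "z \<in> carrier_vec (d i)"
    and "\<And>r. r < d i \<Longrightarrow> z $ r = y $ r - (\<Sum>j = 1..m. (block d A i j *\<^sub>v X j) $ r)"
    and "real k \<le> C2 * (real (d i) * real (total_dim d m))"
proof -
  have "z \<in> carrier_vec (d i) \<and>
      (\<forall>r<d i. z $ r = y $ r - (\<Sum>j = 1..m. (block d A i j *\<^sub>v X j) $ r)) \<and>
      real k \<le> C2 * (real (d i) * real (total_dim d m))"
    using assms(2,4)
  proof (induction m arbitrary: z k)
    case 0
    then show ?case using assms(3) by simp
  next
    case (Suc m)
    obtain y' k1 where e: "eliminate P d A X i y m = (y', k1)"
      by fastforce
    obtain z' k2 where dc: "decouple P (block d A i (Suc m)) (X (Suc m)) y' = (z', k2)"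
      by fastforce
    have zk: "z = z'" "k = k1 + k2"
      using Suc.prems(2) e dc by auto
    have IH: "y' \<in> carrier_vec (d i)"
      "\<And>r. r < d i \<Longrightarrow> y' $ r = y $ r - (\<Sum>j = 1..m. (block d A i j *\<^sub>v X j) $ r)"
      "real k1 \<le> C2 * (real (d i) * real (total_dim d m))"
      using Suc.IH[OF _ e] Suc.prems(1) by auto
    have XS: "X (Suc m) \<in> carrier_vec (d (Suc m))"
      using Suc.prems(1) by simp
    note dcl = cost_model_decouple[OF assms(1) block_carrier[of d A i "Suc m"] XS IH(1) dc]
    have c: "block d A i (Suc m) *\<^sub>v X (Suc m) \<in> carrier_vec (d i)"
      by (rule mult_mat_vec_carrier[OF _ XS]) simp
    \<comment> \<open>Without \<open>index_mult_mat_vec\<close> the entries of products stay folded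
      and match the summands of the induction hypothesis.\<close>
    show ?case
      using IH dcl(2) c unfolding zk dcl(1) by (auto simp: algebra_simps simp del: index_mult_mat_vec)
  qed
  then show "z \<in> carrier_vec (d i)"
    and "\<And>r. r < d i \<Longrightarrow> z $ r = y $ r - (\<Sum>j = 1..m. (block d A i j *\<^sub>v X j) $ r)"
    and "real k \<le> C2 * (real (d i) * real (total_dim d m))"
    by auto
qed

text \<open>Elimination moves the known couplings to the right-hand side, the dense solve settles
  the diagonal block, and later steps leave the blocks already computed unchanged.\<close>

lemma forward_subst_correct:
  assumes cm: "cost_model c1 C1 c2 C2 C3 P"
    and "invertible_diagonal_blocks d m A" "forward_subst P d A b m = (X, k)"
  shows "\<And>j. j \<in> {1..m} \<Longrightarrow> X j \<in> carrier_vec (d j)"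
    and "\<And>i r. i \<in> {1..m} \<Longrightarrow> r < d i \<Longrightarrow>
      (\<Sum>j = 1..i. (block d A i j *\<^sub>v X j) $ r) = b $ (offset d i + r)"
    and "real k \<le> (\<Sum>i = 1..m. C1 * real (d i) ^ 3 + C2 * (real (d i) * real (offset d i)))"
proof -
  have "(\<forall>j\<in>{1..m}. X j \<in> carrier_vec (d j)) \<and>
      (\<forall>i\<in>{1..m}. \<forall>r<d i. (\<Sum>j = 1..i. (block d A i j *\<^sub>v X j) $ r) = b $ (offset d i + r)) \<and>
      real k \<le> (\<Sum>i = 1..m. C1 * real (d i) ^ 3 + C2 * (real (d i) * real (offset d i)))"
    using assms(2,3)
  proof (induction m arbitrary: X k)
    case 0
    then show ?case by simp
  next
    case (Suc m)
    let ?n = "Suc m"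
    obtain X' k1 where f: "forward_subst P d A b m = (X', k1)"
      by fastforce
    obtain y k2 where e: "eliminate P d A X' ?n (segment d b ?n) m = (y, k2)"
      by fastforce
    obtain x k3 where s: "dense_solve P (block d A ?n ?n) y = (x, k3)"
      by fastforce
    have Xk: "X = X'(?n := x)" "k = k1 + k2 + k3"
      using Suc.prems(2) f e s by auto
    have "invertible_diagonal_blocks d m A"
      using Suc.prems(1) by (auto simp: invertible_diagonal_blocks_def)
    then have IH: "\<And>j. j \<in> {1..m} \<Longrightarrow> X' j \<in> carrier_vec (d j)"
      "\<And>i r. i \<in> {1..m} \<Longrightarrow> r < d i \<Longrightarrow>
        (\<Sum>j = 1..i. (block d A i j *\<^sub>v X' j) $ r) = b $ (offset d i + r)"
      "real k1 \<le> (\<Sum>i = 1..m. C1 * real (d i) ^ 3 + C2 * (real (d i) * real (offset d i)))"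
      using Suc.IH[OF _ f] by auto
    note el = eliminate_correct[OF cm IH(1) segment_carrier e]
    have "invertible_mat (block d A ?n ?n)"
      using Suc.prems(1) by (auto simp: invertible_diagonal_blocks_def)
    note ds = cost_model_dense_solve[OF cm block_carrier[of d A ?n ?n] el(1) this s]
    have Ax: "block d A ?n ?n *\<^sub>v x = y"
      by (rule ds(2))
    \<comment> \<open>The row \<open>i'\<close> is independent of the bound \<open>i\<close> because
      the new row \<open>Suc m\<close> needs the sum up to \<open>m\<close> only.\<close>
    have sum_X: "(\<Sum>j = 1..i. (block d A i' j *\<^sub>v X j) $ r)
        = (\<Sum>j = 1..i. (block d A i' j *\<^sub>v X' j) $ r)" if "i \<le> m" for i i' r
      using that unfolding Xk by (intro sum.cong) auto
    have "(\<Sum>j = 1..i. (block d A i j *\<^sub>v X j) $ r) = b $ (offset d i + r)"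
      if i: "i \<in> {1..?n}" and r: "r < d i" for i r
    proof (cases "i = ?n")
      case True
      have "(\<Sum>j = 1..?n. (block d A ?n j *\<^sub>v X j) $ r)
          = (\<Sum>j = 1..m. (block d A ?n j *\<^sub>v X' j) $ r) + (block d A ?n ?n *\<^sub>v x) $ r"
        using sum_X[of m ?n r] by (simp add: Xk(1) del: index_mult_mat_vec)
      \<comment> \<open>The diagonal product equals \<open>y\<close>, the segment of
        \<open>b\<close> minus the couplings, so the couplings cancel.\<close>
      also have "\<dots> = b $ (offset d ?n + r)"
        using r True el(2)[of r] by (simp add: Ax segment_def del: index_mult_mat_vec)
      finally show ?thesis
        using True by simp
    next
      case False
      then show ?thesis
        using i r IH(2)[of i r] sum_X[of i i r] by simp
    qed
    moreover have "\<forall>j\<in>{1..?n}. X j \<in> carrier_vec (d j)"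
      using IH(1) ds(1) Xk(1) by auto
    \<comment> \<open>The factor \<open>total_dim d m\<close> in the elimination cost is the offset
      of block \<open>?n\<close>.\<close>
    moreover have "real k \<le> (\<Sum>i = 1..?n. C1 * real (d i) ^ 3 + C2 * (real (d i) * real (offset d i)))"
      using IH(3) el(3) ds(3) Xk(2) by simp
    ultimately show ?case by blast
  qed
  then show "\<And>j. j \<in> {1..m} \<Longrightarrow> X j \<in> carrier_vec (d j)"
    and "\<And>i r. i \<in> {1..m} \<Longrightarrow> r < d i \<Longrightarrow>
      (\<Sum>j = 1..i. (block d A i j *\<^sub>v X j) $ r) = b $ (offset d i + r)"
    and "real k \<le> (\<Sum>i = 1..m. C1 * real (d i) ^ 3 + C2 * (real (d i) * real (offset d i)))"
    by auto
qed

text \<open>Each block contributes one dense solve against a plain segment of \<open>b\<close>, so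
  no coupling term arises.\<close>

lemma diagonal_subst_cost:
  assumes cm: "cost_model c1 C1 c2 C2 C3 P" and "invertible_diagonal_blocks d m A"
  shows "real (snd (diagonal_subst P d A b m)) \<le> (\<Sum>i = 1..m. C1 * real (d i) ^ 3)"
  using assms(2)
proof (induction m)
  case (Suc m)
  let ?n = "Suc m"
  obtain x k where s: "dense_solve P (block d A ?n ?n) (segment d b ?n) = (x, k)"
    by fastforce
  have inv: "invertible_mat (block d A ?n ?n)" "invertible_diagonal_blocks d m A"
    using Suc.prems by (auto simp: invertible_diagonal_blocks_def)
  have "real k \<le> C1 * real (d ?n) ^ 3"
    using cost_model_dense_solve(3)[OF cm block_carrier[of d A ?n ?n] segment_carrier inv(1) s] .
  then show ?case
    using Suc.IH[OF inv(2)] s by (simp add: case_prod_beta)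
qed simp

section \<open>Bounds for the two systems and the overhead\<close>

text \<open>This discharges the premise under which \<open>structural_assumptions\<close> speaks
  about the \<open>Q\<close>-system.\<close>

lemma solve_D_solution:
  assumes "cost_model c1 C1 c2 C2 C3 P" "structural_assumptions S"
  shows "fst (solve_D P S) \<in> carrier_vec (unknowns_D S)"
    and "mat_D S *\<^sub>v fst (solve_D P S) = rhs_D S"
proof -
  obtain X k where f: "forward_subst P (size_D S) (mat_D S) (rhs_D S) (s2 S - 1) = (X, k)"
    by fastforce
  have inv: "invertible_diagonal_blocks (size_D S) (s2 S - 1) (mat_D S)"
    and tri: "block_lower_triangular (size_D S) (s2 S - 1) (mat_D S)"
    and rhs: "rhs_D S \<in> carrier_vec (total_dim (size_D S) (s2 S - 1))"
    using assms(2) by (auto simp: structural_assumptions_def unknowns_D_def)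
  note fs = forward_subst_correct[OF assms(1) inv f]
  have x: "fst (solve_D P S) = join X (s2 S - 1)"
    using f by (simp add: solve_D_def)
  show "fst (solve_D P S) \<in> carrier_vec (unknowns_D S)"
    unfolding x unknowns_D_def by (rule join_carrier) (rule fs(1))
  show "mat_D S *\<^sub>v fst (solve_D P S) = rhs_D S"
    unfolding x using tri rhs fs(1,2) by (rule mult_mat_join_eqI)
qed

text \<open>There are at most \<open>s\<close> blocks. Each costs at most \<open>C1 * s^3\<close>
  for its dense solve and \<open>C2 * s * s^2\<close> for its couplings, since its offset is at most
  \<open>s^2\<close>.\<close>

lemma cost_D_le:
  assumes "cost_model c1 C1 c2 C2 C3 P" "structural_assumptions S" "0 \<le> C1" "0 \<le> C2"
  shows "real (cost_D P S) \<le> (C1 + C2) * real (stages S) ^ 4"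
proof -
  let ?d = "size_D S" and ?m = "s2 S - 1" and ?s = "real (stages S)"
  obtain X k where f: "forward_subst P ?d (mat_D S) (rhs_D S) ?m = (X, k)"
    by fastforce
  have inv: "invertible_diagonal_blocks ?d ?m (mat_D S)"
    and ms: "?m \<le> stages S" and d: "\<And>i. i \<in> {1..?m} \<Longrightarrow> ?d i \<le> i"
    using assms(2) by (auto simp: structural_assumptions_def)
  have "real k \<le> (\<Sum>i = 1..?m. C1 * real (?d i) ^ 3 + C2 * (real (?d i) * real (offset ?d i)))"
    using forward_subst_correct(3)[OF assms(1) inv f] .
  also have "\<dots> \<le> (\<Sum>i = 1..?m. (C1 + C2) * ?s ^ 3)"
  proof (rule sum_mono)
    fix i assume i: "i \<in> {1..?m}"
    have di: "?d i \<le> stages S"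
      using d[OF i] i ms by auto
    \<comment> \<open>The offset of block \<open>i\<close> is the total size of the
      \<open>j = i - 1\<close> blocks before it.\<close>
    obtain j where j: "i = Suc j" "j \<le> ?m"
      using i by (cases i) auto
    have "total_dim ?d j \<le> j * stages S"
      by (rule total_dim_le) (use d j ms in \<open>fastforce intro: order_trans\<close>)
    also have "\<dots> \<le> stages S * stages S"
      using j ms by simp
    finally have "real (offset ?d i) \<le> ?s * ?s"
      using j(1) by (simp flip: of_nat_mult)
    then have "real (?d i) * real (offset ?d i) \<le> ?s * (?s * ?s)"
      using di by (intro mult_mono) auto
    moreover have "real (?d i) ^ 3 \<le> ?s ^ 3"
      using di by (intro power_mono) auto
    ultimately show "C1 * real (?d i) ^ 3 + C2 * (real (?d i) * real (offset ?d i))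
        \<le> (C1 + C2) * ?s ^ 3"
      using assms(3,4)
      by (simp add: distrib_right power3_eq_cube mult.assoc add_mono mult_left_mono)
  qed
  also have "\<dots> = real ?m * ((C1 + C2) * ?s ^ 3)"
    by simp
  also have "\<dots> \<le> ?s * ((C1 + C2) * ?s ^ 3)"
    using ms assms(3,4) by (intro mult_right_mono) auto
  also have "\<dots> = (C1 + C2) * ?s ^ 4"
    by (simp add: eval_nat_numeral)
  finally show ?thesis
    using f by (simp add: cost_D_def solve_D_def)
qed

lemma cost_Q_le:
  assumes "cost_model c1 C1 c2 C2 C3 P" "structural_assumptions S" "0 \<le> C1"
  shows "real (cost_Q P S) \<le> C1 * real (stages S) ^ 4"
proof -
  let ?x = "fst (solve_D P S)" and ?q = "size_Q S" and ?m = "stages S - 1" and ?s = "real (stages S)"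
  \<comment> \<open>Available because \<open>?x\<close> has been shown to solve the
    \<open>D\<close>-system.\<close>
  have "invertible_diagonal_blocks ?q ?m (mat_Q S ?x)"
    using assms(2) solve_D_solution[OF assms(1,2)] by (auto simp: structural_assumptions_def)
  then have "real (cost_Q P S) \<le> (\<Sum>i = 1..?m. C1 * real (?q i) ^ 3)"
    using diagonal_subst_cost[OF assms(1)] by (simp add: cost_Q_def solve_Q_def case_prod_beta)
  \<comment> \<open>Block sizes are at most \<open>l + 1\<close>, hence at most
    \<open>s\<close>.\<close>
  also have "\<dots> \<le> (\<Sum>i = 1..?m. C1 * ?s ^ 3)"
    using assms(2,3)
    by (intro sum_mono mult_left_mono power_mono) (force simp: structural_assumptions_def)+
  also have "\<dots> = real ?m * (C1 * ?s ^ 3)"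
    by simp
  also have "\<dots> \<le> ?s * (C1 * ?s ^ 3)"
    using assms(3) by (intro mult_right_mono) auto
  also have "\<dots> = C1 * ?s ^ 4"
    by (simp add: eval_nat_numeral)
  finally show ?thesis .
qed

text \<open>Each system has at most \<open>s\<close> blocks of size at most
  \<open>s\<close>.\<close>

lemma unknowns_le:
  assumes "structural_assumptions S"
  shows "unknowns S \<le> 2 * stages S ^ 2"
proof -
  have "s2 S \<le> stages S" "param_l S + 1 \<le> stages S"
    and d: "\<And>i. i \<in> {1..s2 S - 1} \<Longrightarrow> size_D S i \<le> i"
    and q: "\<And>j. j \<in> {1..stages S - 1} \<Longrightarrow> size_Q S j \<le> param_l S + 1"
    using assms by (auto simp: structural_assumptions_def)
  have "unknowns_D S \<le> (s2 S - 1) * stages S"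
    unfolding unknowns_D_def
    by (rule total_dim_le) (use d \<open>s2 S \<le> stages S\<close> in fastforce)
  also have "\<dots> \<le> stages S * stages S"
    using \<open>s2 S \<le> stages S\<close> by (intro mult_right_mono) auto
  finally have D: "unknowns_D S \<le> stages S * stages S" .
  have "unknowns_Q S \<le> (stages S - 1) * stages S"
    unfolding unknowns_Q_def
    by (rule total_dim_le) (use q \<open>param_l S + 1 \<le> stages S\<close> in fastforce)
  also have "\<dots> \<le> stages S * stages S"
    by (intro mult_right_mono) auto
  finally show ?thesis
    using D by (simp add: unknowns_def power2_eq_square)
qed

lemma cost_total_eq: "cost_total P S = overhead P S + cost_D P S + cost_Q P S"
  by (simp add: cost_total_def construct_def cost_D_def cost_Q_def case_prod_beta)

text \<open>Choosing \<open>K\<close> and \<open>L\<close> before \<open>P\<close> and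
  \<open>S\<close> expresses uniformity of the implied constants. The bound with \<open>K\<close>
  renders the term O(N) in the cost formula.\<close>

theorem theorem5p3:
  fixes c1 C1 c2 C2 C3 :: real
  assumes "0 < c1" "0 < C1" "0 < c2" "0 < C2" "0 < C3"
  shows "\<exists>K>0. \<exists>L>0. \<forall>P S. cost_model c1 C1 c2 C2 C3 P \<longrightarrow> structural_assumptions S \<longrightarrow>
           \<bar>real (cost_total P S) - (real (cost_D P S) + real (cost_Q P S))\<bar> \<le> K * real (unknowns S) \<and>
           real (cost_total P S) \<le> L * real (stages S) ^ 4"
\<comment> \<open>The second witness adds \<open>C1 + C2\<close> from the \<open>D\<close>-system,
  \<open>C1\<close> from the \<open>Q\<close>-system and \<open>2 * C3\<close> from the
  overhead.\<close>
proof (rule exI[of _ C3], rule conjI[OF assms(5)], rule exI[of _ "2 * C1 + C2 + 2 * C3"],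
    intro conjI allI impI)
  show "0 < 2 * C1 + C2 + 2 * C3"
    using assms by simp
  fix P S
  assume cm: "cost_model c1 C1 c2 C2 C3 P" and S: "structural_assumptions S"
  have ov: "real (overhead P S) \<le> C3 * real (unknowns S)"
    using cm S by (simp add: cost_model_def)
  \<comment> \<open>The difference is exactly the overhead, which is nonnegative.\<close>
  then show "\<bar>real (cost_total P S) - (real (cost_D P S) + real (cost_Q P S))\<bar>
      \<le> C3 * real (unknowns S)"
    by (simp add: cost_total_eq)
  \<comment> \<open>This follows from \<open>param_l S + 1 \<le> stages S\<close> and lets the
    quadratic bound on the unknowns be raised to the fourth power.\<close>
  have "1 \<le> stages S"
    using S by (simp add: structural_assumptions_def)
  then have "stages S ^ 2 \<le> stages S ^ 4"
    by (intro power_increasing) auto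
  then have "unknowns S \<le> 2 * stages S ^ 4"
    using unknowns_le[OF S] by linarith
  then have "real (unknowns S) \<le> 2 * real (stages S) ^ 4"
    by (metis of_nat_le_iff of_nat_mult of_nat_numeral of_nat_power)
  then have "C3 * real (unknowns S) \<le> C3 * (2 * real (stages S) ^ 4)"
    using assms(5) by (intro mult_left_mono) auto
  then show "real (cost_total P S) \<le> (2 * C1 + C2 + 2 * C3) * real (stages S) ^ 4"
    using ov cost_D_le[OF cm S] cost_Q_le[OF cm S] assms(2,4)
    by (simp add: cost_total_eq algebra_simps)
qed

end
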